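(* Let $X$ be a weakly Lindelöf Urysohn space with a regular $G_\delta$-diagonal. Then $|X|\le 2^{2^{\omega}}$.
   Context: A topological space $X$ is Urysohn if every two distinct points of $X$ have disjoint closed neighborhoods. Write $\Delta_X=\{(x,x)\in X^2:x\in X\}$. $X$ has a regular $G_\delta$-diagonal if there is a sequence $(U_n:n<\omega)$ of open sets in $X^2$ such that $\Delta_X=\bigcap_{n<\omega}U_n=\bigcap_{n<\omega}\overline{U_n}$. $X$ is weakly Lindelöf if every open cover of $X$ has a countable subcollection whose union is dense in $X$. *)

theory Defs
  imports "HOL-Analysis.Analysis"
begin

unbundle cardinal_syntax

definition Urysohn_space :: "'a topology \<Rightarrow> bool" where
  "Urysohn_space X \<longleftrightarrow>
     (\<forall>x\<in>topspace X. \<forall>y\<in>topspace X. x \<noteq> y \<longrightarrow>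
        (\<exists>C D. closedin X C \<and> closedin X D \<and>
               x \<in> X interior_of C \<and> y \<in> X interior_of D \<and> C \<inter> D = {}))"

definition diagonal_of :: "'a topology \<Rightarrow> ('a \<times> 'a) set" where
  "diagonal_of X = {(x, x) | x. x \<in> topspace X}"

definition regular_Gdelta_diagonal :: "'a topology \<Rightarrow> bool" where
  "regular_Gdelta_diagonal X \<longleftrightarrow>
     (\<exists>U :: nat \<Rightarrow> ('a \<times> 'a) set.
        (\<forall>n. openin (prod_topology X X) (U n)) \<and>
        diagonal_of X = (\<Inter>n. U n) \<and>
        diagonal_of X = (\<Inter>n. prod_topology X X closure_of U n))"

definition weakly_Lindelof_space :: "'a topology \<Rightarrow> bool" where
  "weakly_Lindelof_space X \<longleftrightarrow>
     (\<forall>\<U>. (\<forall>U\<in>\<U>. openin X U) \<and> \<Union>\<U> = topspace X \<longrightarrow>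
        (\<exists>\<V>. countable \<V> \<and> \<V> \<subseteq> \<U> \<and> X closure_of (\<Union>\<V>) = topspace X))"

end

(* Zenor: if the closures of the U n meet in the diagonal, the open squares inside the U n give
   open covers C n such that distinct points x, y have, for some n, neighbourhoods O, P which no
   member of C n meets simultaneously.  Weak Lindelofness thins C n to a countable V n with dense
   union.  Assign to x the family of all traces {W in V n. W meets O}, for n a natural number and
   O a neighbourhood of x.  Traces are nonempty by density, so x and y are told apart:
   the trace of P, disjoint from the trace of O, is not the trace of any neighbourhood of x.
   The points thus inject into the double power set of the countable disjoint union of the V n. *)
theory Submission
  imports Defs "HOL-Library.Countable_Set_Type"
begin

text \<open>Phrased with an upper bound \<open>r\<close> in place of \<open>|A|\<close> itself, so
  that it can be iterated: the bound \<open>ctwo ^c r\<close> it yields is again a cardinal to which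
  it applies.\<close>

lemma card_of_Pow_ordLeq_cexp:
  assumes "|A| \<le>o r" "Card_order r"
  shows "|Pow A| \<le>o ctwo ^c r"
proof -
  have "|A| \<le>o |Field r|"
    using assms card_of_Field_ordIso ordIso_symmetric ordLeq_ordIso_trans by blast
  then obtain f where "inj_on f A" "f ` A \<subseteq> Field r"
    unfolding card_of_ordLeq[symmetric] by blast
  then have "inj_on (image f) (Pow A)" "image f ` Pow A \<subseteq> Pow (Field r)"
    by (auto simp: inj_on_image_Pow)
  then have "|Pow A| \<le>o |Pow (Field r)|"
    unfolding card_of_ordLeq[symmetric] by blast
  also have "|Pow (Field r)| =o ctwo ^c r"
    unfolding ctwo_def cexp_def Field_card_of by (rule card_of_Pow_Func)
  finally show ?thesis .
qed

text \<open>For distinct points, \<open>(x, y)\<close> misses the closure of some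
  \<open>U n\<close>, hence lies in an open box \<open>P \<times> Q\<close> disjoint from
  \<open>U n\<close>. A set \<open>W\<close> with \<open>W \<times> W \<subseteq> U n\<close> that
  met both \<open>P\<close> and \<open>Q\<close> would give a point of the box in
  \<open>U n\<close>.\<close>

lemma regular_Gdelta_diagonal_separating_covers:
  assumes "regular_Gdelta_diagonal X"
  obtains \<C> :: "nat \<Rightarrow> 'a set set"
  where "\<forall>n. \<forall>W\<in>\<C> n. openin X W"
    and "\<forall>n. \<Union>(\<C> n) = topspace X"
    and "\<forall>x\<in>topspace X. \<forall>y\<in>topspace X. x \<noteq> y \<longrightarrow>
           (\<exists>n P Q. openin X P \<and> openin X Q \<and> x \<in> P \<and> y \<in> Q \<and>
                   (\<forall>W\<in>\<C> n. W \<inter> P = {} \<or> W \<inter> Q = {}))"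
proof -
  obtain U :: "nat \<Rightarrow> ('a \<times> 'a) set"
    where U: "\<And>n. openin (prod_topology X X) (U n)"
      and diag: "diagonal_of X = (\<Inter>n. U n)"
      and diag_closure: "diagonal_of X = (\<Inter>n. prod_topology X X closure_of U n)"
    using assms unfolding regular_Gdelta_diagonal_def by blast
  define \<C> where "\<C> n = {W. openin X W \<and> W \<times> W \<subseteq> U n}" for n
  show thesis
  proof
    show "\<forall>n. \<forall>W\<in>\<C> n. openin X W"
      by (simp add: \<C>_def)
    show "\<forall>n. \<Union>(\<C> n) = topspace X"
    proof (intro allI equalityI)
      fix n
      show "\<Union>(\<C> n) \<subseteq> topspace X"
        by (auto simp: \<C>_def dest: openin_subset)
      show "topspace X \<subseteq> \<Union>(\<C> n)"
      proof
        fix x assume "x \<in> topspace X"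
        then have "(x, x) \<in> U n"
          using diag by (auto simp: diagonal_of_def)
        then obtain V W where "openin X V" "openin X W" "x \<in> V" "x \<in> W" "V \<times> W \<subseteq> U n"
          using U[of n] unfolding openin_prod_topology_alt by metis
        \<comment> \<open>Intersecting the two sides of a box around \<open>(x, x)\<close> turns it
          into a square.\<close>
        then have "V \<inter> W \<in> \<C> n" "x \<in> V \<inter> W"
          by (auto simp: \<C>_def)
        then show "x \<in> \<Union>(\<C> n)" by blast
      qed
    qed
    show "\<forall>x\<in>topspace X. \<forall>y\<in>topspace X. x \<noteq> y \<longrightarrow>
           (\<exists>n P Q. openin X P \<and> openin X Q \<and> x \<in> P \<and> y \<in> Q \<and>
                   (\<forall>W\<in>\<C> n. W \<inter> P = {} \<or> W \<inter> Q = {}))"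
    proof (intro ballI impI)
      fix x y assume xy: "x \<in> topspace X" "y \<in> topspace X" "x \<noteq> y"
      have "(x, y) \<notin> diagonal_of X"
        using xy by (simp add: diagonal_of_def)
      then obtain n where "(x, y) \<notin> prod_topology X X closure_of U n"
        using diag_closure by blast
      then obtain T where T: "(x, y) \<in> T" "openin (prod_topology X X) T" "U n \<inter> T = {}"
        using xy(1,2) unfolding in_closure_of topspace_prod_topology by blast
      then obtain P Q where PQ: "openin X P" "openin X Q" "x \<in> P" "y \<in> Q" "P \<times> Q \<subseteq> T"
        unfolding openin_prod_topology_alt by metis
      have "W \<inter> P = {} \<or> W \<inter> Q = {}" if "W \<in> \<C> n" for W
        using that T(3) PQ(5) by (auto simp: \<C>_def)
      with PQ show "\<exists>n P Q. openin X P \<and> openin X Q \<and> x \<in> P \<and> y \<in> Q \<and>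
                      (\<forall>W\<in>\<C> n. W \<inter> P = {} \<or> W \<inter> Q = {})"
        by blast
    qed
  qed
qed

lemma weakly_Lindelof_regular_Gdelta_diagonal_card:
  assumes "weakly_Lindelof_space X" "regular_Gdelta_diagonal X"
  shows "|topspace X| \<le>o ctwo ^c (ctwo ^c natLeq)"
proof -
  obtain \<C> :: "nat \<Rightarrow> 'a set set"
    where open_\<C>: "\<forall>n. \<forall>W\<in>\<C> n. openin X W"
      and cover: "\<forall>n. \<Union>(\<C> n) = topspace X"
      and sep: "\<forall>x\<in>topspace X. \<forall>y\<in>topspace X. x \<noteq> y \<longrightarrow>
           (\<exists>n P Q. openin X P \<and> openin X Q \<and> x \<in> P \<and> y \<in> Q \<and>
                   (\<forall>W\<in>\<C> n. W \<inter> P = {} \<or> W \<inter> Q = {}))"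
    by (rule regular_Gdelta_diagonal_separating_covers[OF assms(2)])
  have "\<forall>n. \<exists>\<V>. countable \<V> \<and> \<V> \<subseteq> \<C> n \<and> X closure_of (\<Union>\<V>) = topspace X"
  proof
    fix n
    have "(\<forall>W\<in>\<C> n. openin X W) \<and> \<Union>(\<C> n) = topspace X"
      using open_\<C> cover by simp
    with assms(1) show "\<exists>\<V>. countable \<V> \<and> \<V> \<subseteq> \<C> n \<and> X closure_of (\<Union>\<V>) = topspace X"
      unfolding weakly_Lindelof_space_def by (elim allE impE)
  qed
  then obtain \<V> where countable_\<V>: "\<And>n. countable (\<V> n)" and sub: "\<And>n. \<V> n \<subseteq> \<C> n"
    and dense: "\<And>n. X closure_of (\<Union>(\<V> n)) = topspace X"
    by metis
  \<comment> \<open>The tag \<open>n\<close> lets a nonempty trace determine its level, even when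
    the same open set belongs to several \<open>\<V> n\<close>.\<close>
  define trace where "trace n P = {n} \<times> {W \<in> \<V> n. W \<inter> P \<noteq> {}}" for n P
  define \<Phi> where "\<Phi> x = {trace n P | n P. openin X P \<and> x \<in> P}" for x
  have trace_nonempty: "trace n P \<noteq> {}" if "openin X P" "x \<in> P" for n P x
  proof -
    have "\<Union>(\<V> n) \<inter> P \<noteq> {}"
      using dense[of n] that unfolding dense_intersects_open by blast
    then show ?thesis by (auto simp: trace_def)
  qed
  have "inj_on \<Phi> (topspace X)"
  proof (rule inj_onI, rule ccontr)
    fix x y assume xy: "x \<in> topspace X" "y \<in> topspace X" "\<Phi> x = \<Phi> y" "x \<noteq> y"
    obtain n P Q where PQ: "openin X P" "openin X Q" "x \<in> P" "y \<in> Q"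
      and disj: "\<forall>W\<in>\<C> n. W \<inter> P = {} \<or> W \<inter> Q = {}"
      using sep xy(1,2,4) by metis
    \<comment> \<open>Equality of the families forces the trace of \<open>Q\<close> to come from a
      neighbourhood \<open>R\<close> of \<open>x\<close> as well, a priori at another level
      \<open>m\<close>.\<close>
    have "trace n Q \<in> \<Phi> x"
      using PQ xy(3) by (auto simp: \<Phi>_def)
    then obtain m R where R: "openin X R" "x \<in> R" "trace n Q = trace m R"
      by (auto simp: \<Phi>_def)
    obtain p where p: "p \<in> trace n Q"
      using trace_nonempty[OF PQ(2,4)] by blast
    with R(3) have "p \<in> trace m R" by simp
    with p have "m = n"
      unfolding trace_def by blast
    \<comment> \<open>\<open>R \<inter> P\<close> is still a neighbourhood of \<open>x\<close>, so
      its trace is nonempty; yet by monotonicity it lies in the traces of both \<open>Q\<close> and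
      \<open>P\<close>, which separation makes disjoint.\<close>
    have "trace n (R \<inter> P) \<subseteq> trace n R \<inter> trace n P"
      unfolding trace_def by blast
    also have "\<dots> = trace n Q \<inter> trace n P"
      using R(3) \<open>m = n\<close> by simp
    also have "\<dots> = {}"
      using disj sub unfolding trace_def by blast
    finally show False
      using trace_nonempty[of "R \<inter> P" x n] R PQ by auto
  qed
  moreover have "\<Phi> ` topspace X \<subseteq> Pow (Pow (Sigma UNIV \<V>))"
    by (auto simp: \<Phi>_def trace_def)
  ultimately have "|topspace X| \<le>o |Pow (Pow (Sigma UNIV \<V>))|"
    unfolding card_of_ordLeq[symmetric] by blast
  moreover have "|Sigma UNIV \<V>| \<le>o natLeq"
    unfolding countable_card_le_natLeq[symmetric] by (simp add: countable_\<V>)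
  then have "|Pow (Pow (Sigma UNIV \<V>))| \<le>o ctwo ^c (ctwo ^c natLeq)"
    by (intro card_of_Pow_ordLeq_cexp natLeq_Card_order Card_order_cexp)
  ultimately show ?thesis
    by (rule ordLeq_transitive)
qed

theorem corollary4p5:
  fixes X :: "'a topology"
  assumes "weakly_Lindelof_space X"
    and "Urysohn_space X"
    and "regular_Gdelta_diagonal X"
  shows "|topspace X| \<le>o ctwo ^c (ctwo ^c natLeq)"
  using assms(1,3) by (rule weakly_Lindelof_regular_Gdelta_diagonal_card)

end
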